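(* Let $M=2^{2\lambda}$ with $\lambda$ a positive integer and $M>4$, let $\mathcal{S}$ be the square $M$-QAM signal set, and let $\mu:\mathcal{S}\to\mathbb{F}_2^{2\lambda}$ be any bijective labelling of the signal points by binary $2\lambda$-tuples, used at both end nodes. Then the Latin Square given by bitwise XOR, i.e. the map $(x_A,x_B)\mapsto \mu(x_A)\oplus\mu(x_B)$ on $\mathcal{S}^2$, does not remove the singular fade state $z=1$.
   Context: The square $M$-QAM signal set is $\mathcal{S}=\{a+jb : a,b\in P\}$ with $P=\{-(\sqrt M-1)+2n : n=0,1,\dots,\sqrt M-1\}$, $j=\sqrt{-1}$. A fade state is a nonzero complex number $z$; it is a singular fade state for $\mathcal{S}$ if $\{x+z y : x,y\in\mathcal{S}\}$ has fewer than $|\mathcal{S}|^2$ elements. A Latin Square indexed by $\mathcal{S}$ (rows by the symbol $x_A$ of node A, columns by the symbol $x_B$ of node B) is regarded as a map $L$ on $\mathcal{S}^2$ taking values in a finite symbol set, in which each symbol occurs at most once in each row and each column; its clusters are the sets of cells holding the same symbol. $L$ removes the singular fade state $z$ if its minimum cluster distance at $z$, $$\min\{|(x_A-x_A')+z(x_B-x_B')| : (x_A,x_B),(x_A',x_B')\in\mathcal{S}^2,\ L(x_A,x_B)\ne L(x_A',x_B')\},$$ is strictly positive; equivalently, any two pairs in $\mathcal{S}^2$ with $x_A+zx_B=x_A'+zx_B'$ hold the same symbol. *)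

theory Defs
  imports Complex_Main "HOL-Library.Z2"
begin

text \<open>
  The bound \<open>real n \<le> sqrt M - 1\<close> is the range \<open>n = 0, 1, \<dots>, sqrt M - 1\<close>
  when \<open>M\<close> is a perfect square, the only case in which the definition is used.
\<close>

definition pam_points :: "nat \<Rightarrow> real set" where
  "pam_points M =
    {- (sqrt (real M) - 1) + 2 * real n | n :: nat. real n \<le> sqrt (real M) - 1}"

definition qam :: "nat \<Rightarrow> complex set" where
  "qam M = {complex_of_real a + \<i> * complex_of_real b | a b.
     a \<in> pam_points M \<and> b \<in> pam_points M}"

definition singular_fade_state :: "complex set \<Rightarrow> complex \<Rightarrow> bool" where
  "singular_fade_state S z \<longleftrightarrow>
     z \<noteq> 0 \<and> card {x + z * y | x y. x \<in> S \<and> y \<in> S} < (card S)\<^sup>2"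

text \<open>
  All maps \<open>L\<close> below take the row index (symbol of node A) first and the column index
  (symbol of node B) second; only their values on \<open>S \<times> S\<close> matter.
\<close>

definition latin_square :: "complex set \<Rightarrow> 's set \<Rightarrow> (complex \<Rightarrow> complex \<Rightarrow> 's) \<Rightarrow> bool" where
  "latin_square S T L \<longleftrightarrow>
     finite T \<and> (\<forall>x\<in>S. \<forall>y\<in>S. L x y \<in> T) \<and>
     (\<forall>x\<in>S. inj_on (\<lambda>y. L x y) S) \<and>
     (\<forall>y\<in>S. inj_on (\<lambda>x. L x y) S)"

text \<open>
  For finite \<open>S\<close> with at least two points and \<open>L\<close> a Latin square on \<open>S\<close>, the set of
  distances is finite and nonempty, so \<^const>\<open>Min\<close> is its actual minimum.
\<close>

definition min_cluster_distance ::
    "complex set \<Rightarrow> (complex \<Rightarrow> complex \<Rightarrow> 's) \<Rightarrow> complex \<Rightarrow> real" where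
  "min_cluster_distance S L z =
     Min {cmod ((xA - xA') + z * (xB - xB')) | xA xB xA' xB'.
            xA \<in> S \<and> xB \<in> S \<and> xA' \<in> S \<and> xB' \<in> S \<and> L xA xB \<noteq> L xA' xB'}"

definition removes_fade_state ::
    "complex set \<Rightarrow> (complex \<Rightarrow> complex \<Rightarrow> 's) \<Rightarrow> complex \<Rightarrow> bool" where
  "removes_fade_state S L z \<longleftrightarrow> min_cluster_distance S L z > 0"

text \<open>
  The type \<^typ>\<open>bit\<close> is the two-element field, so its addition is XOR.
\<close>

definition binary_tuples :: "nat \<Rightarrow> bit list set" where
  "binary_tuples n = {v. length v = n}"

definition bitwise_xor :: "bit list \<Rightarrow> bit list \<Rightarrow> bit list" where
  "bitwise_xor u v = map2 (+) u v"

definition xor_square :: "(complex \<Rightarrow> bit list) \<Rightarrow> complex \<Rightarrow> complex \<Rightarrow> bit list" where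
  "xor_square \<mu> xA xB = bitwise_xor (\<mu> xA) (\<mu> xB)"

end

theory Submission
  imports Defs
begin

(* For M > 4 some row of the constellation contains three equally spaced points x, y, z, so
   y + y = x + z.  Removing the fade state 1 would force
   mu x XOR mu z = mu y XOR mu y = 0, i.e. mu x = mu z, although x and z are distinct. *)

lemma length_bitwise_xor [simp]: "length (bitwise_xor u v) = min (length u) (length v)"
  by (simp add: bitwise_xor_def)

lemma bitwise_xor_commute: "bitwise_xor u v = bitwise_xor v u"
proof (rule nth_equalityI)
  fix i assume "i < length (bitwise_xor u v)"
  then show "bitwise_xor u v ! i = bitwise_xor v u ! i"
    using add.commute[of "u ! i" "v ! i"] by (simp add: bitwise_xor_def del: bit_eq_iff)
qed (simp add: min.commute)

text \<open>Translation by \<open>u\<close> in the group of bit tuples is injective. The lengths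
  must agree because \<open>map2\<close> truncates to the shorter list.\<close>

lemma bitwise_xor_left_cancel:
  assumes "length u = length v" "length u = length w"
  shows "bitwise_xor u v = bitwise_xor u w \<longleftrightarrow> v = w"
proof -
  have "a + b = a + c \<longleftrightarrow> b = c" for a b c :: bit
    by (rule add_left_cancel)
  with assms show ?thesis
    by (simp add: bitwise_xor_def list_eq_iff_nth_eq del: Z2.bit_eq_iff)
qed

text \<open>In characteristic 2 every tuple is its own inverse, so the right-hand side is the zero
  tuple whatever \<open>w\<close> is, and two tuples sum to zero exactly when they coincide.\<close>

lemma bitwise_xor_eq_self_iff:
  assumes "length u = n" "length v = n" "length w = n"
  shows "bitwise_xor u v = bitwise_xor w w \<longleftrightarrow> u = v"
proof -
  have "a + b = c + c \<longleftrightarrow> a = b" for a b c :: bit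
    by (cases a; cases b; cases c) simp_all
  with assms show ?thesis
    by (auto simp: bitwise_xor_def list_eq_iff_nth_eq)
qed

lemma finite_binary_tuples: "finite (binary_tuples n)"
proof -
  have "(UNIV :: bit set) \<subseteq> {0, 1}"
    by (auto intro: bit.exhaust)
  then have "finite (UNIV :: bit set)"
    by (rule finite_subset) simp
  then show ?thesis
    using finite_lists_length_eq[of "UNIV :: bit set" n] by (simp add: binary_tuples_def)
qed

text \<open>Row \<open>x\<close> is the injective labelling followed by translation by
  \<open>\<mu> x\<close>. Since XOR commutes, each column is the row of the same index.\<close>

lemma latin_square_xor_square:
  assumes "inj_on \<mu> S" "\<mu> ` S \<subseteq> binary_tuples n"
  shows "latin_square S (binary_tuples n) (xor_square \<mu>)"
proof -
  have len: "length (\<mu> x) = n" if "x \<in> S" for x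
    using assms(2) that by (auto simp: binary_tuples_def)
  have right: "inj_on (\<lambda>y. xor_square \<mu> x y) S" if "x \<in> S" for x
    using that assms(1) by (auto simp: inj_on_def xor_square_def bitwise_xor_left_cancel len)
  moreover have "inj_on (\<lambda>x. xor_square \<mu> x y) S" if "y \<in> S" for y
    using right[OF that] by (simp add: xor_square_def bitwise_xor_commute)
  moreover have "xor_square \<mu> x y \<in> binary_tuples n" if "x \<in> S" "y \<in> S" for x y
    using that by (simp add: xor_square_def binary_tuples_def len)
  ultimately show ?thesis
    by (simp add: latin_square_def finite_binary_tuples)
qed

text \<open>Finiteness is what gives \<open>Min\<close> in the cluster distance, and
  \<open>card\<close> in the notion of singularity, their intended meaning.\<close>

lemma finite_qam: "finite (qam M)"
proof -
  let ?c = "sqrt (real M) - 1"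
  have "{n. real n \<le> ?c} \<subseteq> {..nat \<lfloor>?c\<rfloor>}"
    using le_nat_floor by blast
  then have "finite {n. real n \<le> ?c}"
    by (rule finite_subset) simp
  then have "finite ((\<lambda>n. - ?c + 2 * real n) ` {n. real n \<le> ?c})"
    by (rule finite_imageI)
  then have "finite (pam_points M)"
    by (simp add: pam_points_def setcompr_eq_image)
  then have "finite ((\<lambda>(a, b). complex_of_real a + \<i> * complex_of_real b) `
      (pam_points M \<times> pam_points M))"
    by simp
  then show ?thesis
    by (rule finite_subset[rotated]) (auto simp: qam_def)
qed

lemma qam_arithmetic_progression:
  assumes "M \<ge> 9"
  obtains x y z where "x \<in> qam M" "y \<in> qam M" "z \<in> qam M" "x \<noteq> z" "x + z = y + y"
proof -
  define p where "p n = - (sqrt (real M) - 1) + 2 * real n" for n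
  \<comment> \<open>The points \<open>f 0\<close>, \<open>f 1\<close>, \<open>f 2\<close> are the
    first three in the row of lowest imaginary part. They exist because \<open>M \<ge> 9\<close>
    makes the largest admissible index \<open>sqrt M - 1\<close> at least 2.\<close>
  define f where "f n = complex_of_real (p n) + \<i> * complex_of_real (p 0)" for n
  have "sqrt 9 \<le> sqrt (real M)"
    using assms by (intro real_sqrt_le_mono) simp
  moreover have "sqrt 9 = 3"
    by (rule real_sqrt_unique) simp_all
  ultimately have "real n \<le> sqrt (real M) - 1" if "n \<le> 2" for n
    using that by linarith
  then have "p n \<in> pam_points M" if "n \<le> 2" for n
    using that unfolding pam_points_def p_def by blast
  then have mem: "f n \<in> qam M" if "n \<le> 2" for n
    using that unfolding qam_def f_def by blast
  show thesis
  proof (rule that)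
    show "f 0 \<in> qam M" "f 1 \<in> qam M" "f 2 \<in> qam M"
      by (simp_all add: mem)
    show "f 0 \<noteq> f 2" "f 0 + f 2 = f 1 + f 1"
      by (simp_all add: f_def p_def complex_eq_iff)
  qed
qed

text \<open>Swapping two distinct points leaves their sum unchanged, so addition is not injective on
  \<open>S \<times> S\<close>; as this set is finite, the image is strictly smaller.\<close>

lemma singular_fade_state_1:
  assumes "finite S" "x \<in> S" "y \<in> S" "x \<noteq> y"
  shows "singular_fade_state S 1"
proof -
  let ?f = "\<lambda>(x, y). x + y :: complex"
  have "\<not> inj_on ?f (S \<times> S)"
  proof
    assume "inj_on ?f (S \<times> S)"
    moreover have "?f (x, y) = ?f (y, x)"
      by (simp add: add.commute)
    ultimately have "(x, y) = (y, x)"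
      by (rule inj_onD) (simp_all add: assms(2,3))
    with assms(4) show False
      by simp
  qed
  moreover have fin: "finite (S \<times> S)"
    using assms(1) by simp
  ultimately have "card (?f ` (S \<times> S)) \<noteq> card (S \<times> S)"
    using eq_card_imp_inj_on by blast
  with card_image_le[OF fin] have "card (?f ` (S \<times> S)) < card (S \<times> S)"
    by (rule le_neq_implies_less)
  moreover have "{x + 1 * y | x y. x \<in> S \<and> y \<in> S} = ?f ` (S \<times> S)"
    by auto
  ultimately show ?thesis
    unfolding singular_fade_state_def
    by (simp only: card_cartesian_product power2_eq_square) simp
qed

text \<open>Two cells that coincide at \<open>z\<close> but hold different symbols would contribute
  the distance 0, and the minimum of the finite set of distances could not be positive.\<close>

lemma removes_fade_state_imp_eq:
  assumes "finite S" "removes_fade_state S L z"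
    and "xA \<in> S" "xB \<in> S" "xA' \<in> S" "xB' \<in> S" "xA + z * xB = xA' + z * xB'"
  shows "L xA xB = L xA' xB'"
proof (rule ccontr)
  assume neq: "L xA xB \<noteq> L xA' xB'"
  let ?D = "{cmod ((xA - xA') + z * (xB - xB')) | xA xB xA' xB'.
    xA \<in> S \<and> xB \<in> S \<and> xA' \<in> S \<and> xB' \<in> S \<and> L xA xB \<noteq> L xA' xB'}"
  have "?D \<subseteq> (\<lambda>(xA, xB, xA', xB'). cmod ((xA - xA') + z * (xB - xB'))) ` (S \<times> S \<times> S \<times> S)"
    by force
  then have "finite ?D"
    by (rule finite_subset) (simp add: assms(1))
  moreover have "0 = cmod ((xA - xA') + z * (xB - xB'))"
    using assms(7) by (simp add: algebra_simps)
  then have "0 \<in> ?D"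
    using assms(3-6) neq by blast
  ultimately have "Min ?D \<le> 0"
    by (rule Min_le)
  with assms(2) show False
    by (simp add: removes_fade_state_def min_cluster_distance_def)
qed

theorem mainTheorem4:
  fixes M l :: nat and \<mu> :: "complex \<Rightarrow> bit list"
  assumes "l > 0" and "M = 2 ^ (2 * l)" and "M > 4"
    and "bij_betw \<mu> (qam M) (binary_tuples (2 * l))"
  shows "latin_square (qam M) (binary_tuples (2 * l)) (xor_square \<mu>)
    \<and> singular_fade_state (qam M) 1
    \<and> \<not> removes_fade_state (qam M) (xor_square \<mu>) 1"
proof -
  have inj: "inj_on \<mu> (qam M)" and img: "\<mu> ` qam M = binary_tuples (2 * l)"
    using assms(4) by (auto simp: bij_betw_def)
  \<comment> \<open>The value \<open>l = 1\<close> gives the excluded \<open>M = 4\<close>. Hence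
    \<open>l \<ge> 2\<close> and \<open>M \<ge> 16\<close>, which is more than the three points per
    row require.\<close>
  have "l \<noteq> 1"
    using assms(2,3) by auto
  then have "(2::nat) ^ 4 \<le> 2 ^ (2 * l)"
    using assms(1) by (intro power_increasing) simp_all
  then have "M \<ge> 9"
    by (simp add: assms(2))
  then obtain x y z where xyz: "x \<in> qam M" "y \<in> qam M" "z \<in> qam M" "x \<noteq> z" "x + z = y + y"
    by (rule qam_arithmetic_progression)
  have "\<not> removes_fade_state (qam M) (xor_square \<mu>) 1"
  proof
    assume rem: "removes_fade_state (qam M) (xor_square \<mu>) 1"
    \<comment> \<open>The conflict is between an off-diagonal cell and a diagonal one: all diagonal
      cells hold the zero tuple, and no other cell does.\<close>
    have "xor_square \<mu> x z = xor_square \<mu> y y"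
      by (rule removes_fade_state_imp_eq[OF finite_qam rem xyz(1,3,2,2)]) (simp add: xyz(5))
    moreover have "length (\<mu> w) = 2 * l" if "w \<in> qam M" for w
      using img that by (auto simp: binary_tuples_def)
    ultimately have "\<mu> x = \<mu> z"
      using bitwise_xor_eq_self_iff[of "\<mu> x" "2 * l" "\<mu> z" "\<mu> y"] xyz(1-3)
      by (simp add: xor_square_def)
    with inj_onD[OF inj _ xyz(1,3)] xyz(4) show False
      by blast
  qed
  with latin_square_xor_square[OF inj] img singular_fade_state_1[OF finite_qam xyz(1,3,4)]
  show ?thesis by simp
qed

end
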